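(* Let $D\subset\mathbb{C}$ be a bounded simply connected regular open set. Then for any $\delta>0$ there exists an entire function $f$ for which $D^{-\delta}$ is contained in a periodic Fatou component $U$ with $D^{-\delta}\subset U\subset D$, where $$D^{-\delta}:=\{z\in D:\ \operatorname{dist}(z,\mathbb{C}\setminus D)>\delta\}.$$
   Context: An open set $D$ is regular if $D=\operatorname{Int}(\overline{D})$. $\operatorname{dist}$ is Euclidean distance. For an entire function $f$, $f^n$ is the $n$-th iterate; the Fatou set $\mathcal{F}(f)$ is the set of points having an open neighborhood on which $\{f^n\}$ is a normal family, and a Fatou component is a connected component of $\mathcal{F}(f)$. A Fatou component $U$ is periodic if $f^p(U)\subseteq U$ for some integer $p>0$. *)

theory Defs
  imports "HOL-Complex_Analysis.Complex_Analysis"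
begin

text \<open>Inverse stereographic projection of the plane onto the unit sphere of
  \<open>\<complex> \<times> \<real>\<close>; infinity corresponds to \<open>(0, 1)\<close>, and \<open>dist (stereo z) (stereo w)\<close> is the
  chordal distance.\<close>

definition stereo :: "complex \<Rightarrow> complex \<times> real" where
  "stereo z = ((2 / (1 + (cmod z)\<^sup>2)) *\<^sub>R z, ((cmod z)\<^sup>2 - 1) / ((cmod z)\<^sup>2 + 1))"

text \<open>Normality is in the sense of maps into the Riemann sphere, so that locally uniform
  divergence to infinity is allowed. The limit \<open>g\<close> automatically takes values in the unit sphere,
  which is closed.\<close>

definition normal_family_on :: "complex set \<Rightarrow> (complex \<Rightarrow> complex) set \<Rightarrow> bool" where
  "normal_family_on V \<H> \<longleftrightarrow>
     (\<forall>h :: nat \<Rightarrow> complex \<Rightarrow> complex. range h \<subseteq> \<H> \<longrightarrow>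
        (\<exists>(r :: nat \<Rightarrow> nat) (g :: complex \<Rightarrow> complex \<times> real). strict_mono r \<and>
           (\<forall>K. compact K \<and> K \<subseteq> V \<longrightarrow>
              uniform_limit K (\<lambda>n z. stereo (h (r n) z)) g sequentially)))"

definition fatou_set :: "(complex \<Rightarrow> complex) \<Rightarrow> complex set" where
  "fatou_set f = {z. \<exists>V. open V \<and> z \<in> V \<and> normal_family_on V (range (\<lambda>n. f ^^ n))}"

definition fatou_component :: "(complex \<Rightarrow> complex) \<Rightarrow> complex set \<Rightarrow> bool" where
  "fatou_component f U \<longleftrightarrow> U \<in> components (fatou_set f)"

definition periodic_fatou_component :: "(complex \<Rightarrow> complex) \<Rightarrow> complex set \<Rightarrow> bool" where
  "periodic_fatou_component f U \<longleftrightarrow>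
     fatou_component f U \<and> (\<exists>p::nat. p > 0 \<and> (f ^^ p) ` U \<subseteq> U)"

definition regular_open :: "complex set \<Rightarrow> bool" where
  "regular_open D \<longleftrightarrow> open D \<and> D = interior (closure D)"

text \<open>Since \<open>infdist z {} = 0\<close>, this is meaningful only for \<open>D \<noteq> UNIV\<close>, for instance for bounded
  \<open>D\<close>.\<close>

definition inner_parallel_set :: "complex set \<Rightarrow> real \<Rightarrow> complex set" where
  "inner_parallel_set D \<delta> = {z \<in> D. infdist z (- D) > \<delta>}"

end

theory Submission
  imports Defs
begin

text \<open>The idea is Hilbert's lemniscate theorem. Let \<open>g\<close> be a Riemann map from the unit disc onto \<open>D\<close>,
  let \<open>a = g 0\<close> and \<open>K = g (cball 0 r)\<close> with \<open>r < 1\<close> so large that \<open>K\<close> contains the inner parallel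
  set. An entire function \<open>q\<close> that is tiny on \<open>K - a\<close> and huge off \<open>D - a\<close> gives
  \<open>f z = a + (z - a) * q (z - a)\<close>, for which \<open>a\<close> is an attracting fixed point whose basin contains
  the interior of \<open>K\<close>, whereas \<open>f\<close> maps the complement of \<open>D\<close> into itself. A Fatou component that
  meets the basin lies in it, hence in \<open>D\<close>.

  The function \<open>q\<close> is a multiple of a Faber-type polynomial. Assume \<open>a = 0\<close>, and let \<open>k\<close>, with
  \<open>k 0 = 0\<close>, map the unit disc conformally onto \<open>{u. u = 0 \<or> 1 / u \<notin> K}\<close>. For \<open>w \<in> K\<close> the function
  \<open>deriv k t / (1 - w * k t)\<close> of \<open>t\<close> is holomorphic on the whole disc, so that its Taylor
  coefficients are \<open>O(1 / r ^ n)\<close> for every \<open>r < 1\<close>; for \<open>w = 1 / k \<tau>\<close> its only singularity is a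
  simple pole at \<open>\<tau>\<close>, and the coefficients grow like \<open>1 / \<tau> ^ n\<close>.\<close>

section \<open>Faber-type polynomials\<close>

text \<open>The coefficient of \<open>t ^ n\<close> in \<open>deriv k t / (1 - w * k t)\<close>. It is computed in formal power
  series because the disc on which this quotient is holomorphic depends on \<open>w\<close>.\<close>

definition faber_coeff :: "(complex \<Rightarrow> complex) \<Rightarrow> nat \<Rightarrow> complex \<Rightarrow> complex" where
  "faber_coeff k n w =
     fps_nth (fps_deriv (fps_expansion k 0) * inverse (1 - fps_const w * fps_expansion k 0)) n"

text \<open>The inverse \<open>I\<close> satisfies \<open>I = 1 + w * P * I\<close>. As
  \<open>P\<close> has no constant term, each coefficient of \<open>I\<close> is expressed by
  earlier ones, and holomorphy in \<open>w\<close> follows by induction.\<close>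

lemma holomorphic_fps_nth_inverse:
  fixes P :: "complex fps"
  assumes "fps_nth P 0 = 0"
  shows "(\<lambda>w. fps_nth (inverse (1 - fps_const w * P)) n) holomorphic_on UNIV"
proof (induction n rule: less_induct)
  case (less n)
  define I where "I = (\<lambda>w. inverse (1 - fps_const w * P))"
  have "I w = 1 + fps_const w * (P * I w)" for w
  proof -
    have "I w * (1 - fps_const w * P) = 1"
      unfolding I_def by (rule inverse_mult_eq_1) (simp add: assms)
    then show ?thesis by (simp add: algebra_simps)
  qed
  then have "fps_nth (I w) n = fps_nth (1 + fps_const w * (P * I w)) n" for w
    by metis
  then have eq: "fps_nth (I w) n = (if n = 0 then 1 else 0) +
      w * (\<Sum>i=0..n. fps_nth P i * fps_nth (I w) (n - i))" for w
    unfolding fps_add_nth fps_mult_left_const_nth fps_mult_nth[of P] by simp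
  have "(\<lambda>w. fps_nth P i * fps_nth (I w) (n - i)) holomorphic_on UNIV" if "i \<le> n" for i
  proof (cases "i = 0")
    case False
    then have "n - i < n" using that by simp
    from less[OF this] show ?thesis unfolding I_def by (intro holomorphic_intros)
  qed (simp add: assms)
  then have "(\<lambda>w. \<Sum>i=0..n. fps_nth P i * fps_nth (I w) (n - i)) holomorphic_on UNIV"
    by (intro holomorphic_on_sum) simp
  then have "(\<lambda>w. (if n = 0 then 1 else 0) +
      w * (\<Sum>i=0..n. fps_nth P i * fps_nth (I w) (n - i))) holomorphic_on UNIV"
    by (intro holomorphic_on_add holomorphic_on_mult holomorphic_on_const holomorphic_on_ident)
  then show ?case unfolding eq[symmetric] unfolding I_def .
qed

lemma faber_coeff_holomorphic:
  assumes "k 0 = 0"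
  shows "faber_coeff k n holomorphic_on UNIV"
proof -
  have "fps_nth (fps_expansion k 0) 0 = 0"
    using assms by (simp add: fps_expansion_def)
  then show ?thesis
    unfolding faber_coeff_def [abs_def] fps_mult_nth
    by (intro holomorphic_intros holomorphic_fps_nth_inverse)
qed

text \<open>The equation for \<open>g\<close> becomes one of power series at 0, where
  \<open>1 - w * k\<close> is invertible because \<open>k 0 = 0\<close>. The radius is left free
  because the pole-free disc depends on \<open>w\<close>.\<close>

lemma faber_coeff_eq_taylor_coeff:
  assumes k: "k holomorphic_on ball 0 \<rho>" "k 0 = 0" and "\<rho> > 0"
    and g: "g holomorphic_on ball 0 \<rho>"
    and eq: "\<And>t. t \<in> ball 0 \<rho> \<Longrightarrow> g t * (1 - w * k t) = deriv k t"
  shows "faber_coeff k n w = (deriv ^^ n) g 0 / fact n"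
proof -
  have kf: "k has_fps_expansion fps_expansion k 0"
    using k \<open>\<rho> > 0\<close> by (intro has_fps_expansion_fps_expansion[of "ball 0 \<rho>"]) auto
  have gf: "g has_fps_expansion fps_expansion g 0"
    using g \<open>\<rho> > 0\<close> by (intro has_fps_expansion_fps_expansion[of "ball 0 \<rho>"]) auto
  define P where "P = 1 - fps_const w * fps_expansion k 0"
  have "(\<lambda>t. g t * (1 - w * k t)) has_fps_expansion fps_expansion g 0 * P"
    unfolding P_def by (intro fps_expansion_intros kf gf)
  moreover have "(\<lambda>t. g t * (1 - w * k t)) has_fps_expansion fps_deriv (fps_expansion k 0)"
  proof (subst has_fps_expansion_cong[OF _ refl, of _ "deriv k"])
    show "\<forall>\<^sub>F t in nhds 0. g t * (1 - w * k t) = deriv k t"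
      using eq \<open>\<rho> > 0\<close> eventually_nhds_in_open[of "ball 0 \<rho>" 0] by (auto elim!: eventually_mono)
  qed (intro fps_expansion_intros kf)
  ultimately have "fps_expansion g 0 * P = fps_deriv (fps_expansion k 0)"
    by (rule fps_expansion_unique_complex)
  moreover have "P * inverse P = 1"
    using k(2) by (intro inverse_mult_eq_1') (simp add: P_def fps_expansion_def)
  ultimately have "fps_expansion g 0 = fps_deriv (fps_expansion k 0) * inverse P"
    by (metis mult.assoc mult.right_neutral)
  then show ?thesis
    unfolding faber_coeff_def P_def by (metis fps_nth_fps_expansion gf)
qed

section \<open>Cauchy estimates for the coefficients\<close>

lemma taylor_coeff_bound:
  assumes "f holomorphic_on ball 0 r" "continuous_on (cball 0 r) f" "0 < r"
    and "\<And>t. t \<in> sphere 0 r \<Longrightarrow> cmod (f t) \<le> B"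
  shows "cmod ((deriv ^^ n) f 0 / fact n) \<le> B / r ^ n"
proof -
  have "cmod ((deriv ^^ n) f 0) \<le> fact n * B / r ^ n"
    using assms by (intro Cauchy_inequality) auto
  then show ?thesis
    by (simp add: norm_divide pos_divide_le_eq mult_ac)
qed

text \<open>For \<open>w\<close> in \<open>K\<close> the quotient has no pole in the unit disc, so
  Cauchy's estimate applies on the circle of radius \<open>r < 1\<close>; compactness of
  \<open>K\<close> and of the circle makes the bound uniform.\<close>

lemma faber_coeff_bound_inside:
  assumes k: "k holomorphic_on ball 0 1" "k 0 = 0" and "compact K" and r: "0 < r" "r < 1"
    and nz: "\<And>w t. w \<in> K \<Longrightarrow> t \<in> ball 0 1 \<Longrightarrow> w * k t \<noteq> 1"
  shows "\<exists>M>0. \<forall>w\<in>K. \<forall>n. cmod (faber_coeff k n w) \<le> M / r ^ n"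
proof -
  define G where "G = (\<lambda>w t. deriv k t / (1 - w * k t))"
  have k': "deriv k holomorphic_on ball 0 1"
    by (intro holomorphic_deriv k open_ball)
  have sub: "cball 0 r \<subseteq> (ball 0 1 :: complex set)" "sphere 0 r \<subseteq> (ball 0 1 :: complex set)"
    using r by auto
  have "continuous_on (K \<times> sphere 0 r) (\<lambda>(w, t). G w t)"
    unfolding G_def case_prod_beta
    by (intro continuous_intros continuous_on_compose2[OF holomorphic_on_imp_continuous_on[OF k(1)]]
        continuous_on_compose2[OF holomorphic_on_imp_continuous_on[OF k']])
      (use sub nz in fastforce)+
  then have "bounded ((\<lambda>(w, t). G w t) ` (K \<times> sphere 0 r))"
    by (intro compact_imp_bounded compact_continuous_image compact_Times \<open>compact K\<close> compact_sphere)
  then obtain M where M: "M > 0" "\<And>w t. w \<in> K \<Longrightarrow> t \<in> sphere 0 r \<Longrightarrow> cmod (G w t) \<le> M"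
    unfolding bounded_pos by auto
  have "cmod (faber_coeff k n w) \<le> M / r ^ n" if "w \<in> K" for w n
  proof -
    have G: "G w holomorphic_on ball 0 1"
      unfolding G_def using nz[OF that] by (intro holomorphic_intros k k') auto
    have "cmod ((deriv ^^ n) (G w) 0 / fact n) \<le> M / r ^ n"
    proof (rule taylor_coeff_bound)
      show "G w holomorphic_on ball 0 r"
        using G r by (auto elim: holomorphic_on_subset)
      show "continuous_on (cball 0 r) (G w)"
        using holomorphic_on_imp_continuous_on[OF G] sub continuous_on_subset by blast
    qed (use r M that in auto)
    moreover have "faber_coeff k n w = (deriv ^^ n) (G w) 0 / fact n"
      using nz[OF that] by (intro faber_coeff_eq_taylor_coeff[OF k _ G]) (auto simp: G_def)
    ultimately show ?thesis
      by simp
  qed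
  with M(1) show ?thesis by blast
qed

text \<open>Geometric series: this is what a simple pole at \<open>\<tau>\<close> contributes to the
  coefficients.\<close>

lemma higher_deriv_inverse_linear:
  fixes \<tau> a :: complex
  assumes "\<tau> \<noteq> 0"
  shows "(deriv ^^ n) (\<lambda>t. a / (\<tau> - t)) 0 / fact n = a / \<tau> ^ Suc n"
proof -
  have X: "(\<lambda>t. t) has_fps_expansion (fps_X :: complex fps)"
    by (rule has_fps_expansion_fps_X)
  have "(\<lambda>t. a * inverse (\<tau> - t)) has_fps_expansion fps_const a * inverse (fps_const \<tau> - fps_X)"
    using assms by (intro fps_expansion_intros X) auto
  then have "(\<lambda>t. a / (\<tau> - t)) has_fps_expansion fps_const a * inverse (fps_const \<tau> - fps_X)"
    by (simp only: divide_inverse)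
  then have "(deriv ^^ n) (\<lambda>t. a / (\<tau> - t)) 0 / fact n =
      fps_nth (fps_const a * inverse (fps_const \<tau> - fps_X)) n"
    by (rule fps_nth_fps_expansion[symmetric])
  also have "inverse (fps_const \<tau> - fps_X) = Abs_fps (\<lambda>n. 1 / \<tau> ^ Suc n)"
  proof (rule fps_inverse_unique)
    show "(fps_const \<tau> - fps_X) * Abs_fps (\<lambda>n. 1 / \<tau> ^ Suc n) = 1"
      using assms by (auto simp: fps_eq_iff algebra_simps fps_X_mult_nth split: nat.splits)
        (auto simp: field_simps gr0_conv_Suc)
  qed
  finally show ?thesis by simp
qed

text \<open>At \<open>w = 1 / k \<tau>\<close> injectivity leaves a single simple pole, at
  \<open>\<tau>\<close>, with principal part \<open>k \<tau> / (\<tau> - t)\<close>, which yields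
  the main term. The remainder is holomorphic on the whole disc, so Cauchy's estimate on the circle
  of radius \<open>r\<close>, beyond the pole, bounds the error.\<close>

lemma faber_coeff_bound_outside:
  assumes k: "k holomorphic_on ball 0 1" "k 0 = 0" and inj: "inj_on k (ball 0 1)"
    and s: "0 < s" "s < r" "r < 1"
  shows "\<exists>M. \<forall>\<tau>\<in>cball 0 s - {0}. \<forall>n.
           cmod (faber_coeff k n (1 / k \<tau>) - k \<tau> / \<tau> ^ Suc n) \<le> M / r ^ n"
proof -
  \<comment> \<open>\<open>Q \<tau>\<close> is, up to the factor \<open>- k \<tau>\<close>, the logarithmic derivative of the zero-free difference
    quotient \<open>L \<tau>\<close>, so \<open>R \<tau>\<close> extends it holomorphically over \<open>\<tau>\<close>.\<close>
  define L where "L = (\<lambda>\<tau> t. if t = \<tau> then deriv k \<tau> else (k t - k \<tau>) / (t - \<tau>))"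
  define R where "R = (\<lambda>\<tau> t. - k \<tau> * (deriv (L \<tau>) t / L \<tau> t))"
  define Q where "Q = (\<lambda>\<tau> t. k \<tau> * (deriv k t / (k \<tau> - k t)) - k \<tau> / (\<tau> - t))"
  have k': "deriv k holomorphic_on ball 0 1"
    by (intro holomorphic_deriv k open_ball)
  have kc: "continuous_on (ball 0 1) k" "continuous_on (ball 0 1) (deriv k)"
    using k(1) k' by (auto intro: holomorphic_on_imp_continuous_on)
  have L: "L \<tau> holomorphic_on ball 0 1" for \<tau>
    unfolding L_def by (rule pole_lemma_open[OF k(1) open_ball])
  have Lnz: "L \<tau> t \<noteq> 0" if "\<tau> \<in> ball 0 1" "t \<in> ball 0 1" for \<tau> t
    using holomorphic_injective_imp_regular[OF k(1) open_ball inj] inj that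
    by (auto simp: L_def inj_on_def)
  have R: "R \<tau> holomorphic_on ball 0 1" if "\<tau> \<in> ball 0 1" for \<tau>
    unfolding R_def using Lnz[OF that]
    by (intro holomorphic_intros holomorphic_deriv L open_ball) auto
  have RQ: "R \<tau> t = Q \<tau> t" if \<tau>: "\<tau> \<in> ball 0 1" and t: "t \<in> ball 0 1" "t \<noteq> \<tau>" for \<tau> t
  proof -
    have "(k has_field_derivative deriv k t) (at t)"
      using k(1) t(1) by (intro holomorphic_derivI) auto
    then have "((\<lambda>t. (k t - k \<tau>) / (t - \<tau>)) has_field_derivative
        (deriv k t * (t - \<tau>) - (k t - k \<tau>)) / (t - \<tau>)\<^sup>2) (at t)"
      using t(2) by (auto intro!: derivative_eq_intros simp: power2_eq_square)
    then have "(L \<tau> has_field_derivative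
        (deriv k t * (t - \<tau>) - (k t - k \<tau>)) / (t - \<tau>)\<^sup>2) (at t)"
    proof (rule has_field_derivative_transform_within_open[where S = "- {\<tau>}"])
    qed (use t in \<open>auto simp: L_def\<close>)
    then have dL: "deriv (L \<tau>) t = (deriv k t * (t - \<tau>) - (k t - k \<tau>)) / (t - \<tau>)\<^sup>2"
      by (rule DERIV_imp_deriv)
    have ne: "k t - k \<tau> \<noteq> 0" "t - \<tau> \<noteq> 0" using inj t \<tau> by (auto simp: inj_on_def)
    define x y where "x = k t - k \<tau>" and "y = t - \<tau>"
    have xy: "k \<tau> - k t = - x" "\<tau> - t = - y" by (auto simp: x_def y_def)
    have "deriv (L \<tau>) t / L \<tau> t = (deriv k t * y - x) / y\<^sup>2 / (x / y)"
      using dL t(2) by (simp add: L_def x_def y_def)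
    also have "\<dots> = deriv k t / x - 1 / y"
      using ne unfolding x_def[symmetric] y_def[symmetric]
      by (simp add: field_simps power2_eq_square)
    finally have *: "deriv (L \<tau>) t / L \<tau> t = deriv k t / x - 1 / y" .
    show ?thesis
      unfolding R_def Q_def xy * by (simp add: algebra_simps)
  qed
  have sub: "cball 0 s \<subseteq> (ball 0 1 :: complex set)" "sphere 0 r \<subseteq> (ball 0 1 :: complex set)"
     "cball 0 r \<subseteq> (ball 0 1 :: complex set)" using s by auto
  have ne: "\<tau> \<noteq> t" if "\<tau> \<in> cball 0 s" "t \<in> sphere 0 r" for \<tau> t :: complex
    using that s by auto
  have "continuous_on (cball 0 s \<times> sphere 0 r) (\<lambda>(\<tau>, t). Q \<tau> t)"
  proof -
    have "k \<tau> \<noteq> k t" if "\<tau> \<in> cball 0 s" "t \<in> sphere 0 r" for \<tau> t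
      using inj_onD[OF inj, of \<tau> t] ne[OF that] that sub by blast
    then show ?thesis
      unfolding Q_def case_prod_beta
      by (intro continuous_intros continuous_on_compose2[OF kc(1)] continuous_on_compose2[OF kc(2)])
        (use sub ne in fastforce)+
  qed
  then have "bounded ((\<lambda>(\<tau>, t). Q \<tau> t) ` (cball 0 s \<times> sphere 0 r))"
    by (intro compact_imp_bounded compact_continuous_image compact_Times compact_cball compact_sphere)
  then obtain M where M: "\<And>\<tau> t. \<tau> \<in> cball 0 s \<Longrightarrow> t \<in> sphere 0 r \<Longrightarrow> cmod (Q \<tau> t) \<le> M"
    unfolding bounded_iff by (force simp: Ball_def)
  have "cmod (faber_coeff k n (1 / k \<tau>) - k \<tau> / \<tau> ^ Suc n) \<le> M / r ^ n"
    if \<tau>: "\<tau> \<in> cball 0 s - {0}" for \<tau> n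
  proof -
    have \<tau>1: "\<tau> \<in> ball 0 1" and \<tau>0: "\<tau> \<noteq> 0" using \<tau> sub by auto
    have k\<tau>: "k \<tau> \<noteq> 0" using inj_onD[OF inj, of \<tau> 0] k(2) \<tau>1 \<tau>0 by auto
    have "cmod ((deriv ^^ n) (R \<tau>) 0 / fact n) \<le> M / r ^ n"
    proof (rule taylor_coeff_bound)
      show "R \<tau> holomorphic_on ball 0 r"
        using R[OF \<tau>1] s by (auto elim: holomorphic_on_subset)
      show "continuous_on (cball 0 r) (R \<tau>)"
        using holomorphic_on_imp_continuous_on[OF R[OF \<tau>1]] sub continuous_on_subset by blast
      show "cmod (R \<tau> x) \<le> M" if x: "x \<in> sphere 0 r" for x
      proof -
        show ?thesis using x s RQ[of \<tau> x] \<tau>1 M[of \<tau> x] ne[of \<tau> x] \<tau> by auto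
      qed
    qed (use s in auto)
    moreover have "faber_coeff k n (1 / k \<tau>) =
        (deriv ^^ n) (\<lambda>t. R \<tau> t + k \<tau> / (\<tau> - t)) 0 / fact n"
    proof (rule faber_coeff_eq_taylor_coeff)
      let ?\<rho> = "cmod \<tau>"
      have b: "ball 0 ?\<rho> \<subseteq> (ball 0 1 :: complex set)" using \<tau>1 by auto
      show "k holomorphic_on ball 0 ?\<rho>" using k(1) b by (rule holomorphic_on_subset)
      have "R \<tau> holomorphic_on ball 0 ?\<rho>" using R[OF \<tau>1] b by (rule holomorphic_on_subset)
      then show "(\<lambda>t. R \<tau> t + k \<tau> / (\<tau> - t)) holomorphic_on ball 0 ?\<rho>"
        by (intro holomorphic_intros) auto
      show "(R \<tau> t + k \<tau> / (\<tau> - t)) * (1 - 1 / k \<tau> * k t) = deriv k t" if "t \<in> ball 0 ?\<rho>" for t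
      proof -
        have t: "t \<in> ball 0 1" "t \<noteq> \<tau>" using that b by auto
        have "k \<tau> - k t \<noteq> 0" using inj_onD[OF inj, of \<tau> t] t \<tau>1 by auto
        moreover have "1 - 1 / k \<tau> * k t = (k \<tau> - k t) / k \<tau>"
          using k\<tau> by (simp add: field_simps)
        ultimately show ?thesis
          unfolding RQ[OF \<tau>1 t] Q_def using k\<tau> by simp
      qed
    qed (use \<tau>0 k in auto)
    moreover have "(deriv ^^ n) (\<lambda>t. R \<tau> t + k \<tau> / (\<tau> - t)) 0 / fact n =
        (deriv ^^ n) (R \<tau>) 0 / fact n + k \<tau> / \<tau> ^ Suc n"
    proof -
      let ?\<rho> = "cmod \<tau>"
      have "R \<tau> holomorphic_on ball 0 ?\<rho>"
        using R[OF \<tau>1] by (rule holomorphic_on_subset) (use \<tau>1 in auto)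
      moreover have "(\<lambda>t. k \<tau> / (\<tau> - t)) holomorphic_on ball 0 ?\<rho>"
        by (intro holomorphic_intros) auto
      ultimately have "(deriv ^^ n) (\<lambda>t. R \<tau> t + k \<tau> / (\<tau> - t)) 0 =
          (deriv ^^ n) (R \<tau>) 0 + (deriv ^^ n) (\<lambda>t. k \<tau> / (\<tau> - t)) 0"
        using \<tau>0 by (intro higher_deriv_add[where S = "ball 0 ?\<rho>"]) auto
      then show ?thesis
        using higher_deriv_inverse_linear[OF \<tau>0, of n "k \<tau>"] by (simp add: add_divide_distrib)
    qed
    ultimately show ?thesis
      by simp
  qed
  then show ?thesis by blast
qed

text \<open>On \<open>K\<close> the coefficients are at most \<open>M / r ^ n\<close>, while at
  \<open>1 / k \<tau>\<close> they are at least \<open>c / s ^ n - M' / r ^ n\<close> in modulus. As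
  \<open>s < r\<close>, the ratio of the two bounds tends to infinity, so a multiple of one
  coefficient with large \<open>n\<close> serves as \<open>q\<close>.\<close>

lemma faber_separation:
  assumes k: "k holomorphic_on ball 0 1" "k 0 = 0" and inj: "inj_on k (ball 0 1)"
    and "compact K" and nz: "\<And>w t. w \<in> K \<Longrightarrow> t \<in> ball 0 1 \<Longrightarrow> w * k t \<noteq> 1"
    and s: "0 < s" "s < 1" and "\<epsilon> > 0"
  shows "\<exists>q. q holomorphic_on UNIV \<and> (\<forall>w\<in>K. cmod (q w) \<le> \<epsilon>) \<and>
           (\<forall>\<tau>\<in>cball 0 s - {0}. cmod (q (1 / k \<tau>)) \<ge> B)"
proof -
  define r where "r = (1 + s) / 2"
  have r: "0 < r" "s < r" "r < 1" using s by (auto simp: r_def)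
  obtain M where M: "M > 0" "\<And>w n. w \<in> K \<Longrightarrow> cmod (faber_coeff k n w) \<le> M / r ^ n"
    using faber_coeff_bound_inside[OF k \<open>compact K\<close> r(1,3) nz] by blast
  obtain M' where M': "\<And>\<tau> n. \<tau> \<in> cball 0 s - {0} \<Longrightarrow>
      cmod (faber_coeff k n (1 / k \<tau>) - k \<tau> / \<tau> ^ Suc n) \<le> M' / r ^ n"
    using faber_coeff_bound_outside[OF k inj s(1) r(2,3)] by blast
  \<comment> \<open>The quotient \<open>k \<tau> / \<tau>\<close> extends over 0 by
    \<open>deriv k 0\<close>, and injectivity of \<open>k\<close> makes the extension zero-free;
    \<open>c\<close> is its minimum modulus on the closed disc.\<close>
  obtain c where c: "c > 0" "\<And>\<tau>. \<tau> \<in> cball 0 s - {0} \<Longrightarrow> c \<le> cmod (k \<tau> / \<tau>)"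
  proof -
    define l where "l = (\<lambda>t. if t = 0 then deriv k 0 else (k t - k 0) / (t - 0))"
    have "l holomorphic_on ball 0 1"
      unfolding l_def by (rule pole_lemma_open[OF k(1) open_ball])
    then have "continuous_on (cball 0 s) (\<lambda>t. cmod (l t))"
      using s by (intro continuous_on_norm holomorphic_on_imp_continuous_on)
        (auto elim: holomorphic_on_subset)
    moreover have "compact (cball 0 s :: complex set)" "cball 0 s \<noteq> ({} :: complex set)"
      using s by auto
    ultimately obtain t0 where t0: "t0 \<in> cball 0 s" "\<And>t. t \<in> cball 0 s \<Longrightarrow> cmod (l t0) \<le> cmod (l t)"
      using continuous_attains_inf[of "cball 0 s" "\<lambda>t. cmod (l t)"] by metis
    have "l t0 \<noteq> 0"
      using holomorphic_injective_imp_regular[OF k(1) open_ball inj, of 0]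
        inj_onD[OF inj, of t0 0] t0(1) s k(2)
      by (auto simp: l_def)
    show thesis
    proof (rule that[of "cmod (l t0)"])
      show "cmod (l t0) \<le> cmod (k \<tau> / \<tau>)" if "\<tau> \<in> cball 0 s - {0}" for \<tau>
        using t0(2)[of \<tau>] that k(2) by (simp add: l_def[THEN fun_cong, of \<tau>])
    qed (use \<open>l t0 \<noteq> 0\<close> in simp)
  qed
  \<comment> \<open>This \<open>n\<close> is large enough for the final lower bound
    \<open>\<epsilon> / M * (c * (r / s) ^ n - M')\<close> to reach \<open>B\<close>.\<close>
  obtain n where "(B * M / \<epsilon> + M') / c < (r / s) ^ n"
    using real_arch_pow[of "r / s" "(B * M / \<epsilon> + M') / c"] r s by auto
  then have "B * M / \<epsilon> \<le> c * (r / s) ^ n - M'"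
    using \<open>c > 0\<close> by (simp add: pos_divide_less_eq mult.commute)
  then have n: "B \<le> \<epsilon> / M * (c * (r / s) ^ n - M')"
    using \<open>\<epsilon> > 0\<close> \<open>M > 0\<close> by (simp add: divide_le_eq mult.commute pos_le_divide_eq)
  \<comment> \<open>Normalised so that the bound \<open>M / r ^ n\<close> on \<open>K\<close>
    becomes exactly \<open>\<epsilon>\<close>.\<close>
  define a where "a = \<epsilon> / M * r ^ n"
  have a: "a > 0" using \<open>\<epsilon> > 0\<close> \<open>M > 0\<close> r by (simp add: a_def)
  define q where "q = (\<lambda>w. complex_of_real a * faber_coeff k n w)"
  have "q holomorphic_on UNIV"
    unfolding q_def by (intro holomorphic_intros faber_coeff_holomorphic k)
  moreover have "cmod (q w) \<le> \<epsilon>" if "w \<in> K" for w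
  proof -
    have "cmod (q w) \<le> a * (M / r ^ n)"
      unfolding q_def norm_mult using M(2)[OF that, of n] a by (intro mult_mono) auto
    also have "\<dots> = \<epsilon>" using r M(1) by (simp add: a_def)
    finally show ?thesis .
  qed
  moreover have "cmod (q (1 / k \<tau>)) \<ge> B" if \<tau>: "\<tau> \<in> cball 0 s - {0}" for \<tau>
  proof -
    have "cmod \<tau> ^ n \<le> s ^ n" "cmod \<tau> > 0" using \<tau> by (auto intro: power_mono)
    then have "c / s ^ n \<le> cmod (k \<tau> / \<tau>) / cmod \<tau> ^ n"
      using c(1) c(2)[OF \<tau>] by (intro frac_le) auto
    also have "\<dots> = cmod (k \<tau> / \<tau> ^ Suc n)"
      by (simp add: norm_divide norm_mult norm_power)
    also have "\<dots> \<le> cmod (faber_coeff k n (1 / k \<tau>)) + M' / r ^ n"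
      using M'[OF \<tau>, of n] norm_triangle_sub[of "k \<tau> / \<tau> ^ Suc n" "faber_coeff k n (1 / k \<tau>)"]
      by (simp add: norm_minus_commute)
    finally have "a * (c / s ^ n - M' / r ^ n) \<le> a * cmod (faber_coeff k n (1 / k \<tau>))"
      using a by simp
    moreover have "a * (c / s ^ n - M' / r ^ n) = \<epsilon> / M * (c * (r / s) ^ n - M')"
    proof -
      have "r \<noteq> 0" "s \<noteq> 0" "M \<noteq> 0" using r s M(1) by auto
      then show ?thesis by (simp add: a_def power_divide field_simps)
    qed
    ultimately show ?thesis
      using n a by (simp add: q_def norm_mult)
  qed
  ultimately show ?thesis by blast
qed

section \<open>Hilbert's lemniscate theorem\<close>

lemma compact_subset_open_ball_imp_smaller_ball:
  assumes "compact T" "T \<subseteq> ball (0 :: complex) 1"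
  obtains s where "0 < s" "s < 1" "T \<subseteq> ball 0 s"
proof -
  \<comment> \<open>Adding 0 makes the maximum of the norm exist even for empty \<open>T\<close>.
    The radius will be the midpoint between this maximum and 1.\<close>
  have "compact (insert 0 T)" using assms by simp
  then obtain x where x: "x \<in> insert 0 T" "\<And>y. y \<in> insert 0 T \<Longrightarrow> cmod y \<le> cmod x"
    using continuous_attains_sup[OF _ insert_not_empty continuous_on_norm_id] by metis
  have "cmod x < 1" using x(1) assms(2) by auto
  moreover have "T \<subseteq> ball 0 ((1 + cmod x) / 2)"
  proof
    fix y assume "y \<in> T"
    then show "y \<in> ball 0 ((1 + cmod x) / 2)"
      using x(2)[of y] \<open>cmod x < 1\<close> by simp
  qed
  ultimately show thesis
    by (intro that[of "(1 + cmod x) / 2"]) (auto intro: add_pos_nonneg)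
qed

text \<open>An arbitrary Riemann map is composed with the disc automorphism \<open>p\<close> that
  moves the image of 0 back to 0.\<close>

lemma Riemann_map_fixing_zero:
  assumes "open W" "simply_connected W" "0 \<in> W" "W \<noteq> UNIV"
  obtains h k where "h holomorphic_on W" "k holomorphic_on ball 0 1" "k 0 = 0"
    "\<And>u. u \<in> W \<Longrightarrow> h u \<in> ball 0 1 \<and> k (h u) = u"
    "\<And>t. t \<in> ball 0 1 \<Longrightarrow> k t \<in> W \<and> h (k t) = t"
proof -
  obtain h0 k0 where h0: "h0 holomorphic_on W" "\<And>u. u \<in> W \<Longrightarrow> h0 u \<in> ball 0 1 \<and> k0 (h0 u) = u"
    and k0: "k0 holomorphic_on ball 0 1" "\<And>t. t \<in> ball 0 1 \<Longrightarrow> k0 t \<in> W \<and> h0 (k0 t) = t"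
    using Riemann_mapping_theorem[of W] assms by blast
  have a: "h0 0 \<in> ball 0 1" using h0(2) assms(3) by blast
  obtain p p' where p: "p (h0 0) = 0" "p holomorphic_on ball 0 1" "p ` ball 0 1 \<subseteq> ball 0 1"
      "p' holomorphic_on ball 0 1" "p' ` ball 0 1 \<subseteq> ball 0 1"
      "\<And>z. z \<in> ball 0 1 \<Longrightarrow> p (p' z) = z" "\<And>z. z \<in> ball 0 1 \<Longrightarrow> p' (p z) = z"
    using ball_biholomorphism_exists[OF a] by blast
  show thesis
  proof (rule that)
    show "p \<circ> h0 holomorphic_on W"
      using h0 by (intro holomorphic_on_compose_gen[OF h0(1) p(2)]) auto
    show "k0 \<circ> p' holomorphic_on ball 0 1"
      by (intro holomorphic_on_compose_gen[OF p(4) k0(1)] p)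
    show "(k0 \<circ> p') 0 = 0"
      using p(1) p(7)[OF a] h0(2)[OF assms(3)] by simp
    show "(p \<circ> h0) u \<in> ball 0 1 \<and> (k0 \<circ> p') ((p \<circ> h0) u) = u" if "u \<in> W" for u
      using h0(2)[OF that] p(3) p(7)[of "h0 u"] by (auto simp: image_subset_iff)
    show "(k0 \<circ> p') t \<in> W \<and> (p \<circ> h0) ((k0 \<circ> p') t) = t" if "t \<in> ball 0 1" for t
      using k0(2)[of "p' t"] p(5) p(6)[OF that] that by (auto simp: image_subset_iff)
  qed
qed

text \<open>Inversion turns the exterior of \<open>K\<close>, with infinity, into a bounded domain
  \<open>W\<close> around 0, and that of \<open>D\<close> into a compact subset of \<open>W\<close>.
  The complement of \<open>W\<close> is the inversion of \<open>K - {0}\<close>; this is why the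
  latter is assumed connected, and it makes \<open>W\<close> simply connected. A Riemann map of
  \<open>W\<close> then enters \<open>faber_separation\<close>.\<close>

lemma lemniscate_separation:
  assumes "compact K" "0 \<in> interior K" "connected (K - {0})" "connected (- K)"
    and "open D" "K \<subseteq> D" and "\<epsilon> > 0"
  shows "\<exists>q. q holomorphic_on UNIV \<and> (\<forall>w\<in>K. cmod (q w) \<le> \<epsilon>) \<and> (\<forall>w\<in>- D. cmod (q w) \<ge> B)"
proof -
  \<comment> \<open>Under inversion, the disc inside \<open>K\<close> bounds \<open>W\<close> by
    \<open>1 / d\<close>, and the bound \<open>e\<close> on \<open>K\<close> puts the disc of radius
    \<open>1 / e\<close> into \<open>W\<close>.\<close>
  obtain d where d: "d > 0" "ball 0 d \<subseteq> K"
    using assms(2) by (auto simp: mem_interior)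
  obtain e where e: "e > 0" "K \<subseteq> cball 0 e"
    using compact_imp_bounded[OF assms(1)] by (auto simp: bounded_pos subset_eq)
  \<comment> \<open>Here 0 stands for infinity: only nonzero points of \<open>K\<close> are
    inverted, so 0 belongs to \<open>W\<close>.\<close>
  define W where "W = - (inverse ` (K - {0}))"
  have W_iff: "u \<in> W \<longleftrightarrow> u = 0 \<or> inverse u \<notin> K" for u
    using image_eqI[of u inverse "inverse u" "K - {0}"] by (auto simp: W_def)
  have ballW: "ball 0 (1 / e) \<subseteq> W"
  proof
    fix u :: complex assume u: "u \<in> ball 0 (1 / e)"
    show "u \<in> W"
    proof (cases "u = 0")
      case False
      then have "cmod (inverse u) > e"
        using u e(1) by (simp add: norm_inverse norm_divide field_simps)
      then show ?thesis using e(2) by (auto simp: W_iff)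
    qed (simp add: W_iff)
  qed
  have inv_cont: "continuous_on (- {0}) (inverse :: complex \<Rightarrow> complex)"
    by (intro continuous_intros) auto
  have "open W"
  proof -
    have "open (- {0} \<inter> inverse -` (- K))"
      using assms(1) by (intro continuous_open_preimage inv_cont) (auto simp: compact_imp_closed)
    moreover have "W = ball 0 (1 / e) \<union> (- {0} \<inter> inverse -` (- K))"
      using ballW e(1) by (auto simp: W_iff)
    ultimately show ?thesis by auto
  qed
  have "bounded W"
  proof (rule bounded_subset[OF bounded_cball])
    show "W \<subseteq> cball 0 (1 / d)"
    proof
      fix u assume u: "u \<in> W"
      show "u \<in> cball 0 (1 / d)"
      proof (cases "u = 0")
        case False
        then have "inverse u \<notin> ball 0 d" using u d(2) by (auto simp: W_iff)
        then show ?thesis using False d(1) by (simp add: norm_inverse norm_divide field_simps)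
      qed (use d in simp)
    qed
  qed
  \<comment> \<open>The inverted exterior of \<open>K\<close> is connected and is \<open>W\<close>
    without 0. As 0 is a limit of it, \<open>W\<close> lies between this set and its
    closure.\<close>
  have "connected W"
  proof (rule connected_intermediate_closure)
    have "0 \<notin> - K" using d by auto
    then show "connected (inverse ` (- K))"
      by (intro connected_continuous_image assms continuous_on_subset[OF inv_cont]) auto
    show "inverse ` (- K) \<subseteq> W" by (auto simp: W_iff)
    have "0 \<in> closure (inverse ` (- K))"
      unfolding closure_approachable
    proof (intro allI impI)
      fix x :: real assume "x > 0"
      define m where "m = min (1 / e) x"
      define u where "u = complex_of_real (m / 2)"
      have m: "m > 0" "m \<le> 1 / e" "m \<le> x" using \<open>x > 0\<close> e(1) by (auto simp: m_def)
      moreover have "cmod u = m / 2" using m(1) by (simp add: u_def norm_divide)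
      ultimately have "cmod u > 0" "cmod u < 1 / e" "cmod u < x" by linarith+
      then have "u \<noteq> 0" by simp
      have "u \<in> W" using ballW \<open>cmod u < 1 / e\<close> by auto
      then show "\<exists>y\<in>inverse ` (- K). dist y 0 < x"
        using \<open>u \<noteq> 0\<close> \<open>cmod u < x\<close> by (intro bexI[of _ u] image_eqI[of _ _ "inverse u"]) (auto simp: W_iff)
    qed
    moreover have "W \<subseteq> insert 0 (inverse ` (- K))"
    proof
      fix u assume "u \<in> W"
      then show "u \<in> insert 0 (inverse ` (- K))"
        using image_eqI[of u inverse "inverse u" "- K"] by (auto simp: W_iff)
    qed
    ultimately show "W \<subseteq> closure (inverse ` (- K))"
      using closure_subset by blast
  qed
  moreover have "connected (- W)"
    unfolding W_def double_complement
    by (intro connected_continuous_image assms continuous_on_subset[OF inv_cont]) auto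
  ultimately have "simply_connected W"
    using simply_connected_iff_simple[OF \<open>open W\<close> \<open>bounded W\<close>] by simp
  moreover have "W \<noteq> UNIV" using \<open>bounded W\<close> not_bounded_UNIV by metis
  moreover have "0 \<in> W" by (simp add: W_iff)
  ultimately obtain h k where h: "h holomorphic_on W" "\<And>u. u \<in> W \<Longrightarrow> h u \<in> ball 0 1 \<and> k (h u) = u"
    and k: "k holomorphic_on ball 0 1" "k 0 = 0" "\<And>t. t \<in> ball 0 1 \<Longrightarrow> k t \<in> W \<and> h (k t) = t"
    using Riemann_map_fixing_zero[OF \<open>open W\<close>] by metis
  have inj: "inj_on k (ball 0 1)"
    by (rule inj_on_inverseI[of _ h]) (use k(3) in blast)
  \<comment> \<open>The inverted complement of \<open>D\<close>, with infinity placed at 0. It is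
    compact in \<open>W\<close>, so \<open>h\<close> maps it into a disc of radius
    \<open>s < 1\<close>.\<close>
  define T where "T = - (- {0} \<inter> inverse -` D)"
  have T_iff: "u \<in> T \<longleftrightarrow> u = 0 \<or> inverse u \<notin> D" for u
    by (auto simp: T_def)
  have "T \<subseteq> W" using \<open>K \<subseteq> D\<close> by (auto simp: T_iff W_iff)
  have "closed T"
    unfolding T_def closed_Compl using \<open>open D\<close>
    by (intro closed_Compl continuous_open_preimage inv_cont) auto
  then have "compact T"
    using bounded_subset[OF \<open>bounded W\<close> \<open>T \<subseteq> W\<close>] by (simp add: compact_eq_bounded_closed)
  then have "compact (h ` T)"
    by (intro compact_continuous_image continuous_on_subset[OF holomorphic_on_imp_continuous_on[OF h(1)]]
        \<open>T \<subseteq> W\<close>)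
  moreover have "h ` T \<subseteq> ball 0 1" using h(2) \<open>T \<subseteq> W\<close> by blast
  ultimately obtain s where s: "0 < s" "s < 1" "h ` T \<subseteq> ball 0 s"
    by (rule compact_subset_open_ball_imp_smaller_ball)
  have "w * k t \<noteq> 1" if "w \<in> K" "t \<in> ball 0 1" for w t
  proof
    assume "w * k t = 1"
    then have "k t \<noteq> 0" "inverse (k t) = w"
      using inverse_unique[of "k t" w] by (auto simp: mult.commute)
    then show False using k(3)[OF that(2)] that(1) by (auto simp: W_iff)
  qed
  from faber_separation[OF k(1,2) inj \<open>compact K\<close> this s(1,2) \<open>\<epsilon> > 0\<close>, of B]
  obtain q where q: "q holomorphic_on UNIV" "\<And>w. w \<in> K \<Longrightarrow> cmod (q w) \<le> \<epsilon>"
    "\<And>\<tau>. \<tau> \<in> cball 0 s - {0} \<Longrightarrow> cmod (q (1 / k \<tau>)) \<ge> B" by blast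
  \<comment> \<open>Such a \<open>w\<close> is \<open>1 / k \<tau>\<close> for
    \<open>\<tau> = h (1 / w)\<close>, a nonzero point of the disc of radius
    \<open>s\<close>.\<close>
  have "cmod (q w) \<ge> B" if "w \<in> - D" for w
  proof -
    have "0 \<in> D" using assms(2) \<open>K \<subseteq> D\<close> interior_subset by blast
    then have "w \<noteq> 0" using that by auto
    define u where "u = inverse w"
    have u: "u \<in> T" "u \<noteq> 0" "1 / u = w"
      using that \<open>w \<noteq> 0\<close> by (auto simp: u_def T_iff divide_inverse)
    then have "k (h u) = u" using h(2) \<open>T \<subseteq> W\<close> by blast
    moreover have "h u \<in> cball 0 s - {0}"
      using u s(3) \<open>k (h u) = u\<close> k(2) by (auto simp: image_subset_iff less_imp_le)
    ultimately show ?thesis using q(3)[of "h u"] u by simp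
  qed
  with q(1,2) show ?thesis by blast
qed

section \<open>Dynamics\<close>

lemma continuous_stereo: "continuous_on UNIV stereo"
proof -
  have "1 + (cmod z)\<^sup>2 \<noteq> 0" "(cmod z)\<^sup>2 + 1 \<noteq> 0" for z
    using zero_le_power2[of "cmod z"] by linarith+
  then show ?thesis
    unfolding stereo_def [abs_def] by (intro continuous_intros) auto
qed

lemma isCont_stereo: "isCont stereo a"
  using continuous_stereo by (simp add: continuous_on_eq_continuous_at)

lemma stereo_left_inverse: "fst (stereo z) /\<^sub>R (1 - snd (stereo z)) = z"
proof -
  define c where "c = 2 / (1 + (cmod z)\<^sup>2)"
  have "1 + (cmod z)\<^sup>2 \<noteq> 0" using zero_le_power2[of "cmod z"] by linarith
  then have "1 - snd (stereo z) = c" "c \<noteq> 0"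
    by (auto simp: c_def stereo_def field_simps)
  moreover have "fst (stereo z) = c *\<^sub>R z" by (simp add: stereo_def c_def)
  ultimately show ?thesis by simp
qed

text \<open>The inverse projection, from the pole \<open>(0, 1)\<close>, is continuous at
  \<open>stereo a\<close>, whose last coordinate is not 1 because \<open>a\<close> is
  finite.\<close>

lemma stereo_tendsto_cancel:
  assumes "((\<lambda>n. stereo (x n)) \<longlongrightarrow> stereo a) F"
  shows "(x \<longlongrightarrow> a) F"
proof -
  have "1 + (cmod a)\<^sup>2 \<noteq> 0" using zero_le_power2[of "cmod a"] by linarith
  then have "1 - snd (stereo a) \<noteq> 0" by (simp add: stereo_def field_simps)
  then have "((\<lambda>n. fst (stereo (x n)) /\<^sub>R (1 - snd (stereo (x n)))) \<longlongrightarrow>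
      fst (stereo a) /\<^sub>R (1 - snd (stereo a))) F"
    by (intro tendsto_intros assms)
  then show ?thesis by (simp only: stereo_left_inverse)
qed

text \<open>A sequence of iterates either repeats one of them infinitely often, which gives a
  constant subsequence, or its exponents tend to infinity, and then the whole sequence converges
  uniformly to \<open>a\<close>.\<close>

lemma normal_family_on_iterates:
  assumes lim: "uniform_limit N (\<lambda>n. f ^^ n) (\<lambda>_. a) sequentially"
  shows "normal_family_on N (range (\<lambda>n. f ^^ n))"
  unfolding normal_family_on_def
proof (intro allI impI)
  fix h :: "nat \<Rightarrow> complex \<Rightarrow> complex"
  assume "range h \<subseteq> range (\<lambda>n. f ^^ n)"
  then have "\<forall>k. \<exists>j. h k = f ^^ j" by (auto simp: image_subset_iff image_iff)
  then obtain m where m: "\<And>k. h k = f ^^ m k" by metis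
  show "\<exists>r g. strict_mono r \<and> (\<forall>K. compact K \<and> K \<subseteq> N \<longrightarrow>
      uniform_limit K (\<lambda>n z. stereo (h (r n) z)) g sequentially)"
  proof (cases "\<exists>c. infinite {k. m k = c}")
    case True
    then obtain c where c: "infinite {k. m k = c}" by blast
    then have "strict_mono (enumerate {k. m k = c})"
      by (rule strict_mono_enumerate)
    moreover have "h (enumerate {k. m k = c} n) = f ^^ c" for n
      using enumerate_in_set[OF c, of n] m by simp
    ultimately show ?thesis
      by (intro exI[of _ "enumerate {k. m k = c}"] exI[of _ "\<lambda>z. stereo ((f ^^ c) z)"])
        (simp add: uniform_limit_const)
  next
    case False
    have "filterlim m at_top sequentially"
      unfolding filterlim_at_top
    proof
      fix Z
      have "{x. \<not> Z \<le> m x} = (\<Union>c<Z. {k. m k = c})" by auto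
      then have "finite {x. \<not> Z \<le> m x}" using False by simp
      then show "\<forall>\<^sub>F x in sequentially. Z \<le> m x"
        by (simp only: cofinite_eq_sequentially[symmetric] eventually_cofinite)
    qed
    \<comment> \<open>As the limit is constant, continuity of \<open>stereo\<close> at the one point
      \<open>a\<close> suffices to pass to the chordal metric.\<close>
    have "uniform_limit N (\<lambda>n z. stereo (h n z)) (\<lambda>_. stereo a) sequentially"
      unfolding uniform_limit_iff
    proof (intro allI impI)
      fix e :: real assume "e > 0"
      obtain d where d: "d > 0" "\<And>z. dist z a < d \<Longrightarrow> dist (stereo z) (stereo a) < e"
        using \<open>e > 0\<close> isCont_stereo[of a] unfolding continuous_at_eps_delta by blast
      have "\<forall>\<^sub>F n in sequentially. \<forall>z\<in>N. dist ((f ^^ n) z) a < d"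
        using lim d(1) unfolding uniform_limit_iff by blast
      then have "\<forall>\<^sub>F n in sequentially. \<forall>z\<in>N. dist ((f ^^ m n) z) a < d"
        using \<open>filterlim m at_top sequentially\<close> by (rule eventually_compose_filterlim)
      then show "\<forall>\<^sub>F n in sequentially. \<forall>z\<in>N. dist (stereo (h n z)) (stereo a) < e"
        by eventually_elim (use d(2) m in auto)
    qed
    then show ?thesis
      by (intro exI[of _ id] exI[of _ "\<lambda>_. stereo a"])
        (auto simp: strict_mono_def intro: uniform_limit_on_subset)
  qed
qed

text \<open>The basin \<open>A\<close> of \<open>a\<close> is open, lies in the Fatou set and, by
  normality, is relatively closed in it; so the component of \<open>a\<close> stays in
  \<open>A\<close>. Attraction makes \<open>a\<close> a fixed point, whence this component is mapped
  into itself and the period is 1.\<close>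

lemma attracted_component:
  assumes f: "continuous_on UNIV f" and V: "open V" "connected V" "a \<in> V"
    and lim: "uniform_limit V (\<lambda>n. f ^^ n) (\<lambda>_. a) sequentially"
  obtains U where "periodic_fatou_component f U" "V \<subseteq> U"
    "\<And>z. z \<in> U \<Longrightarrow> (\<lambda>n. (f ^^ n) z) \<longlonglongrightarrow> a"
proof -
  define A where "A = {z. (\<lambda>n. (f ^^ n) z) \<longlonglongrightarrow> a}"
  have fn: "continuous_on UNIV (f ^^ n)" for n
    by (induction n) (auto intro: continuous_on_compose2[OF f] simp: o_def)
  \<comment> \<open>Uniform attraction is pulled back along \<open>f ^^ m\<close>: one visit to
    \<open>V\<close> suffices, with times shifted by \<open>m\<close>.\<close>
  have nbhd: "\<exists>N. open N \<and> z \<in> N \<and> uniform_limit N (\<lambda>n. f ^^ n) (\<lambda>_. a) sequentially"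
    if "(f ^^ m) z \<in> V" for m z
  proof (intro exI conjI)
    show "open ((f ^^ m) -` V)"
      using fn V(1) by (simp add: open_vimage)
    show "z \<in> (f ^^ m) -` V" using that by simp
    show "uniform_limit ((f ^^ m) -` V) (\<lambda>n. f ^^ n) (\<lambda>_. a) sequentially"
      unfolding uniform_limit_iff
    proof (intro allI impI)
      fix e :: real assume "e > 0"
      then obtain M where M: "\<And>n z. n \<ge> M \<Longrightarrow> z \<in> V \<Longrightarrow> dist ((f ^^ n) z) a < e"
        using lim unfolding uniform_limit_iff eventually_sequentially by blast
      have "dist ((f ^^ n) z) a < e" if "n \<ge> M + m" "(f ^^ m) z \<in> V" for n z
      proof -
        have "(f ^^ n) z = (f ^^ (n - m)) ((f ^^ m) z)"
          using that(1) funpow_add[of "n - m" m f] by simp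
        then show ?thesis using M[of "n - m"] that by simp
      qed
      then show "\<forall>\<^sub>F n in sequentially. \<forall>z\<in>(f ^^ m) -` V. dist ((f ^^ n) z) a < e"
        unfolding eventually_sequentially by blast
    qed
  qed
  have A_if: "z \<in> A" if "uniform_limit N (\<lambda>n. f ^^ n) (\<lambda>_. a) sequentially" "z \<in> N" for z N
    using tendsto_uniform_limitI[OF that] by (simp add: A_def)
  have enter: "\<exists>n. x n \<in> V" if "x \<longlonglongrightarrow> a" for x :: "nat \<Rightarrow> complex"
    using topological_tendstoD[OF that V(1,3)] by (auto simp: eventually_sequentially)
  have A_nbhd: "\<exists>N. open N \<and> z \<in> N \<and> uniform_limit N (\<lambda>n. f ^^ n) (\<lambda>_. a) sequentially"
    if "z \<in> A" for z
    using enter[of "\<lambda>n. (f ^^ n) z"] nbhd that by (auto simp: A_def)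
  have "A \<subseteq> fatou_set f"
    using A_nbhd normal_family_on_iterates unfolding fatou_set_def by blast
  have "open A"
  proof (subst open_subopen, intro ballI)
    fix z assume "z \<in> A"
    then obtain N where "open N" "z \<in> N" "uniform_limit N (\<lambda>n. f ^^ n) (\<lambda>_. a) sequentially"
      using A_nbhd by blast
    then show "\<exists>T. open T \<and> z \<in> T \<and> T \<subseteq> A" using A_if by blast
  qed
  have "V \<subseteq> A" using A_if[OF lim] by blast
  have "a \<in> A" using V(3) \<open>V \<subseteq> A\<close> by blast
  have "f a = a"
  proof -
    have "(\<lambda>n. (f ^^ n) a) \<longlonglongrightarrow> a" using \<open>a \<in> A\<close> by (simp add: A_def)
    moreover have "isCont f a" using f by (simp add: continuous_on_eq_continuous_at)
    ultimately have "(\<lambda>n. f ((f ^^ n) a)) \<longlonglongrightarrow> f a"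
      by (rule isCont_tendsto_compose[rotated])
    moreover have "(\<lambda>n. (f ^^ Suc n) a) \<longlonglongrightarrow> a"
      using \<open>(\<lambda>n. (f ^^ n) a) \<longlonglongrightarrow> a\<close> by (rule LIMSEQ_Suc)
    ultimately show ?thesis using LIMSEQ_unique by fastforce
  qed
  define U where "U = connected_component_set (fatou_set f) a"
  have "a \<in> U" unfolding U_def using \<open>a \<in> A\<close> \<open>A \<subseteq> fatou_set f\<close> by auto
  have "connected U" by (simp add: U_def)
  have "U \<subseteq> fatou_set f" unfolding U_def by (rule connected_component_subset)
  \<comment> \<open>A subsequential limit \<open>g\<close> near \<open>z\<close> is continuous and
    equals \<open>stereo a\<close> on \<open>A\<close>, hence also at \<open>z\<close>. So the orbit
    of \<open>z\<close> visits \<open>V\<close>, and by \<open>nbhd\<close> its full sequence of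
    iterates converges to \<open>a\<close>.\<close>
  have A_closed: "z \<in> A" if z: "z \<in> fatou_set f" "z \<in> closure A" for z
  proof -
    obtain N where N: "open N" "z \<in> N" "normal_family_on N (range (\<lambda>n. f ^^ n))"
      using z(1) by (auto simp: fatou_set_def)
    then obtain e where e: "e > 0" "cball z e \<subseteq> N" by (meson open_contains_cball)
    have "\<exists>r g. strict_mono r \<and> (\<forall>K. compact K \<and> K \<subseteq> N \<longrightarrow>
        uniform_limit K (\<lambda>n z. stereo ((f ^^ r n) z)) g sequentially)"
      by (rule N(3)[unfolded normal_family_on_def, rule_format, of "\<lambda>n. f ^^ n"]) simp
    then obtain r g where "strict_mono r"
      and g: "uniform_limit (cball z e) (\<lambda>n z. stereo ((f ^^ r n) z)) g sequentially"
      using e(2) compact_cball by metis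
    have "continuous_on (cball z e) g"
      by (rule uniform_limit_theorem[OF always_eventually g])
        (auto intro!: continuous_on_compose2[OF continuous_stereo] continuous_on_subset[OF fn])
    then have "closed {x \<in> cball z e. g x = stereo a}"
      by (intro continuous_closed_preimage_constant) auto
    moreover have "ball z e \<inter> A \<subseteq> {x \<in> cball z e. g x = stereo a}"
    proof safe
      fix x assume x: "x \<in> ball z e" "x \<in> A"
      show "x \<in> cball z e" using x by simp
      then have "(\<lambda>n. stereo ((f ^^ r n) x)) \<longlonglongrightarrow> g x"
        using tendsto_uniform_limitI[OF g] by simp
      moreover have "(\<lambda>n. (f ^^ r n) x) \<longlonglongrightarrow> a"
        using LIMSEQ_subseq_LIMSEQ[OF _ \<open>strict_mono r\<close>, of "\<lambda>n. (f ^^ n) x"] x(2)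
        by (simp add: A_def o_def)
      then have "(\<lambda>n. stereo ((f ^^ r n) x)) \<longlonglongrightarrow> stereo a"
        by (rule isCont_tendsto_compose[OF isCont_stereo])
      ultimately show "g x = stereo a" by (rule LIMSEQ_unique)
    qed
    ultimately have "closure (ball z e \<inter> A) \<subseteq> {x \<in> cball z e. g x = stereo a}"
      by (intro closure_minimal)
    moreover have "z \<in> closure (ball z e \<inter> A)"
      using open_Int_closure_subset[of "ball z e" A] z(2) e(1) by auto
    ultimately have "g z = stereo a" by blast
    moreover have "(\<lambda>n. stereo ((f ^^ r n) z)) \<longlonglongrightarrow> g z"
      using tendsto_uniform_limitI[OF g, of z] e(1) by simp
    ultimately have "(\<lambda>n. (f ^^ r n) z) \<longlonglongrightarrow> a"
      by (simp add: stereo_tendsto_cancel)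
    then obtain n where "(f ^^ r n) z \<in> V" using enter by blast
    then show ?thesis using nbhd A_if by blast
  qed
  have "U \<subseteq> A"
  proof -
    have "U \<subseteq> A \<union> - closure A" using A_closed \<open>U \<subseteq> fatou_set f\<close> by blast
    then have "A \<inter> U = {} \<or> - closure A \<inter> U = {}"
      using closure_subset[of A] by (intro connectedD[OF \<open>connected U\<close> \<open>open A\<close>]) auto
    then show ?thesis using \<open>a \<in> A\<close> \<open>a \<in> U\<close> \<open>U \<subseteq> A \<union> - closure A\<close> by blast
  qed
  show thesis
  proof (rule that)
    have "f ` U \<subseteq> A"
    proof safe
      fix z assume "z \<in> U"
      then have "(\<lambda>n. (f ^^ n) z) \<longlonglongrightarrow> a" using \<open>U \<subseteq> A\<close> by (auto simp: A_def)
      then have "(\<lambda>n. (f ^^ Suc n) z) \<longlonglongrightarrow> a" by (rule LIMSEQ_Suc)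
      then show "f z \<in> A" by (simp add: A_def funpow_swap1)
    qed
    moreover have "connected (f ` U)"
      by (intro connected_continuous_image \<open>connected U\<close> continuous_on_subset[OF f]) simp
    moreover have "a \<in> f ` U" using \<open>a \<in> U\<close> \<open>f a = a\<close> image_eqI[of a f a U] by simp
    ultimately have "f ` U \<subseteq> U"
      unfolding U_def using \<open>A \<subseteq> fatou_set f\<close> by (intro connected_component_maximal) auto
    then have "(f ^^ 1) ` U \<subseteq> U" by simp
    moreover have "U \<in> components (fatou_set f)"
      unfolding U_def components_def using \<open>a \<in> A\<close> \<open>A \<subseteq> fatou_set f\<close> by blast
    ultimately show "periodic_fatou_component f U"
      unfolding periodic_fatou_component_def fatou_component_def by (intro conjI exI[of _ 1]) auto
    show "V \<subseteq> U"
      unfolding U_def using V \<open>V \<subseteq> A\<close> \<open>A \<subseteq> fatou_set f\<close> by (intro connected_component_maximal) auto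
    show "(\<lambda>n. (f ^^ n) z) \<longlonglongrightarrow> a" if "z \<in> U" for z
      using that \<open>U \<subseteq> A\<close> by (auto simp: A_def)
  qed
qed

section \<open>Construction of the entire function\<close>

theorem theorem2:
  fixes D :: "complex set" and \<delta> :: real
  assumes "D \<noteq> {}"
    and "bounded D"
    and "simply_connected D"
    and "regular_open D"
    and "\<delta> > 0"
  shows "\<exists>f :: complex \<Rightarrow> complex. f holomorphic_on UNIV \<and>
           (\<exists>U. periodic_fatou_component f U \<and> inner_parallel_set D \<delta> \<subseteq> U \<and> U \<subseteq> D)"
proof -
  have "open D" using assms(4) by (simp add: regular_open_def)
  have "D \<noteq> UNIV" using \<open>bounded D\<close> not_bounded_UNIV by metis
  then obtain \<phi> g where \<phi>: "\<phi> holomorphic_on D" "\<And>z. z \<in> D \<Longrightarrow> \<phi> z \<in> ball 0 1 \<and> g (\<phi> z) = z"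
    and g: "g holomorphic_on ball 0 1" "\<And>t. t \<in> ball 0 1 \<Longrightarrow> g t \<in> D \<and> \<phi> (g t) = t"
    using Riemann_mapping_theorem[of D] \<open>open D\<close> assms(1,3) by blast
  have \<phi>c: "continuous_on D \<phi>" and gc: "continuous_on (ball 0 1) g"
    using \<phi>(1) g(1) by (auto intro: holomorphic_on_imp_continuous_on)
  \<comment> \<open>The non-strict inequality makes \<open>S\<close> closed, hence compact; it
    contains the inner parallel set.\<close>
  define S where "S = {z. infdist z (- D) \<ge> \<delta>}"
  have "S \<subseteq> D"
  proof
    fix z assume "z \<in> S"
    then have "infdist z (- D) \<noteq> 0" using \<open>\<delta> > 0\<close> by (simp add: S_def)
    then show "z \<in> D" using infdist_zero[of z "- D"] by blast
  qed
  have "closed S"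
    unfolding S_def by (intro closed_Collect_le continuous_intros)
  then have "compact S"
    using bounded_subset[OF \<open>bounded D\<close> \<open>S \<subseteq> D\<close>] by (simp add: compact_eq_bounded_closed)
  then have "compact (\<phi> ` S)"
    by (intro compact_continuous_image continuous_on_subset[OF \<phi>c] \<open>S \<subseteq> D\<close>)
  moreover have "\<phi> ` S \<subseteq> ball 0 1" using \<phi>(2) \<open>S \<subseteq> D\<close> by blast
  ultimately obtain r where r: "0 < r" "r < 1" "\<phi> ` S \<subseteq> ball 0 r"
    by (rule compact_subset_open_ball_imp_smaller_ball)
  have rsub: "cball 0 r \<subseteq> (ball 0 1 :: complex set)" "ball 0 r \<subseteq> (ball 0 1 :: complex set)"
    using r by auto
  define V where "V = g ` ball 0 r"
  define a where "a = g 0"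
  have V_eq: "V = D \<inter> \<phi> -` ball 0 r"
    using \<phi>(2) g(2) rsub(2) by (force simp: V_def image_iff)
  have "open V"
    unfolding V_eq by (intro continuous_open_preimage \<phi>c \<open>open D\<close> open_ball)
  have "connected V"
    unfolding V_def by (intro connected_continuous_image continuous_on_subset[OF gc rsub(2)] connected_ball)
  have "a \<in> V" using r by (auto simp: V_def a_def)
  have "S \<subseteq> V" using \<open>S \<subseteq> D\<close> r(3) by (auto simp: V_eq)
  define \<gamma> where "\<gamma> = (\<lambda>t. g t - a)"
  define K where "K = \<gamma> ` cball 0 r"
  have \<gamma>c: "continuous_on (cball 0 r) \<gamma>"
    unfolding \<gamma>_def by (intro continuous_intros continuous_on_subset[OF gc rsub(1)])
  have \<gamma>inj: "inj_on \<gamma> (cball 0 r)"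
    using g(2) rsub(1) by (intro inj_on_inverseI[of _ "\<lambda>z. \<phi> (z + a)"]) (auto simp: \<gamma>_def)
  have "compact K"
    unfolding K_def by (intro compact_continuous_image \<gamma>c compact_cball)
  have VK: "z - a \<in> K" if "z \<in> V" for z
    using that by (force simp: V_def K_def \<gamma>_def)
  have "0 \<in> interior K"
  proof (rule interiorI)
    show "open ((\<lambda>z. z - a) ` V)" using \<open>open V\<close> open_translation_subtract by blast
    show "0 \<in> (\<lambda>z. z - a) ` V" using \<open>a \<in> V\<close> by force
    show "(\<lambda>z. z - a) ` V \<subseteq> K" using VK by blast
  qed
  have "connected (K - {0})"
  proof -
    have "\<gamma> 0 = 0" by (simp add: \<gamma>_def a_def)
    then have "K - {0} = \<gamma> ` (cball 0 r - {0})"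
      using inj_on_image_set_diff[OF \<gamma>inj, of "cball 0 r" "{0}"] r by (simp add: K_def)
    moreover have "connected (cball 0 r - {0 :: complex})"
      using r by (intro connected_punctured_convex) (auto simp: aff_dim_cball)
    ultimately show ?thesis
      by (auto intro!: connected_continuous_image continuous_on_subset[OF \<gamma>c])
  qed
  \<comment> \<open>\<open>K\<close> is a homeomorphic image of a closed disc, and such a compact
    set does not separate the plane.\<close>
  have "connected (- K)"
  proof (rule connected_complement_homeomorphic_convex_compact)
    show "K homeomorphic cball (0 :: complex) r"
      unfolding K_def using homeomorphic_compact[OF compact_cball \<gamma>c refl \<gamma>inj] homeomorphic_sym by blast
  qed auto
  obtain d where d: "d > 0" "ball a d \<subseteq> V"
    using \<open>open V\<close> \<open>a \<in> V\<close> by (meson openE)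
  obtain e where e: "e > 0" "D \<subseteq> ball a e"
    using bounded_subset_ballD[OF \<open>bounded D\<close>] by blast
  have "V \<subseteq> D" by (auto simp: V_eq)
  \<comment> \<open>The bound \<open>1 / 2\<close> makes \<open>f\<close> contract \<open>V\<close>
    towards \<open>a\<close>. This alone need not keep \<open>f z\<close> in \<open>V\<close>, which
    may fail to be star-shaped about \<open>a\<close>; the bound \<open>d / (2 * e)\<close> does so
    by placing \<open>f z\<close> in \<open>ball a d\<close>.\<close>
  define \<epsilon> where "\<epsilon> = min (1 / 2) (d / (2 * e))"
  have "\<epsilon> > 0" using d e by (simp add: \<epsilon>_def)
  have "K \<subseteq> (\<lambda>z. z - a) ` D" using g(2) rsub(1) by (auto simp: K_def \<gamma>_def)
  \<comment> \<open>With the value \<open>e / d\<close>, points off \<open>D\<close>, at distance at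
    least \<open>d\<close> from \<open>a\<close>, are sent to distance at least \<open>e\<close>,
    outside \<open>ball a e\<close> and so outside \<open>D\<close>.\<close>
  then obtain q where q: "q holomorphic_on UNIV" "\<And>w. w \<in> K \<Longrightarrow> cmod (q w) \<le> \<epsilon>"
    "\<And>w. w \<notin> (\<lambda>z. z - a) ` D \<Longrightarrow> cmod (q w) \<ge> e / d"
    using lemniscate_separation[OF \<open>compact K\<close> \<open>0 \<in> interior K\<close> \<open>connected (K - {0})\<close>
        \<open>connected (- K)\<close> open_translation_subtract[OF \<open>open D\<close>, of a] _ \<open>\<epsilon> > 0\<close>, of "e / d"]
    by (metis ComplI)
  define f where "f = (\<lambda>z. a + (z - a) * q (z - a))"
  have hol: "f holomorphic_on UNIV"
    unfolding f_def
    by (intro holomorphic_intros holomorphic_on_compose_gen[OF _ q(1), unfolded o_def]) auto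
  have f_dist: "dist (f z) a = dist z a * cmod (q (z - a))" for z
    by (simp add: f_def dist_norm norm_mult)
  have f_in: "f z \<in> V \<and> dist (f z) a \<le> dist z a / 2" if "z \<in> V" for z
  proof -
    have le: "dist (f z) a \<le> dist z a * \<epsilon>"
      unfolding f_dist using q(2)[OF VK[OF that]] by (intro mult_left_mono) auto
    moreover have "dist z a * \<epsilon> \<le> dist z a * (1 / 2)"
      by (intro mult_left_mono) (auto simp: \<epsilon>_def)
    moreover have "dist z a * \<epsilon> < e * (d / e)"
    proof (rule mult_strict_mono)
      show "dist z a < e" using that \<open>V \<subseteq> D\<close> e(2) by (auto simp: dist_commute)
      show "\<epsilon> < d / e" using d e by (simp add: \<epsilon>_def min_less_iff_disj field_simps)
    qed (use e \<open>\<epsilon> > 0\<close> in auto)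
    ultimately show ?thesis using d e by (auto simp: dist_commute)
  qed
  have f_iter: "(f ^^ n) z \<in> V \<and> dist ((f ^^ n) z) a \<le> dist z a * (1 / 2) ^ n" if "z \<in> V" for n z
  proof (induction n)
    case (Suc n)
    then show ?case using f_in[of "(f ^^ n) z"] by auto
  qed (use that in simp)
  have "uniform_limit V (\<lambda>n. f ^^ n) (\<lambda>_. a) sequentially"
    unfolding uniform_limit_iff
  proof (intro allI impI)
    fix x :: real assume "x > 0"
    have "(\<lambda>n. e * (1 / 2) ^ n) \<longlonglongrightarrow> e * 0"
      by (intro tendsto_intros) auto
    then have "\<forall>\<^sub>F n in sequentially. e * (1 / 2) ^ n < x"
      using \<open>x > 0\<close> by (intro order_tendstoD) auto
    then show "\<forall>\<^sub>F n in sequentially. \<forall>z\<in>V. dist ((f ^^ n) z) a < x"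
    proof eventually_elim
      case (elim n)
      show ?case
      proof
        fix z assume z: "z \<in> V"
        then have "dist z a \<le> e" using \<open>V \<subseteq> D\<close> e(2) by (auto simp: dist_commute)
        then have "dist z a * (1 / 2) ^ n \<le> e * (1 / 2) ^ n" by (intro mult_right_mono) auto
        then show "dist ((f ^^ n) z) a < x" using f_iter[OF z, of n] elim by linarith
      qed
    qed
  qed
  then obtain U where U: "periodic_fatou_component f U" "V \<subseteq> U"
    "\<And>z. z \<in> U \<Longrightarrow> (\<lambda>n. (f ^^ n) z) \<longlonglongrightarrow> a"
    using attracted_component[OF holomorphic_on_imp_continuous_on[OF hol] \<open>open V\<close> \<open>connected V\<close> \<open>a \<in> V\<close>]
    by blast
  have f_out: "f z \<notin> D" if "z \<notin> D" for z
  proof -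
    have "d \<le> dist z a" using that d(2) \<open>V \<subseteq> D\<close> by (force simp: dist_commute)
    moreover have "e / d \<le> cmod (q (z - a))" using that by (intro q(3)) auto
    ultimately have "d * (e / d) \<le> dist (f z) a"
      unfolding f_dist using d e by (intro mult_mono) auto
    then have "e \<le> dist (f z) a" using d by simp
    then show ?thesis using e(2) by (force simp: dist_commute)
  qed
  \<comment> \<open>An orbit starting off \<open>D\<close> never enters \<open>D\<close>, whereas
    every orbit in \<open>U\<close> converges to the point \<open>a\<close> of the open set
    \<open>D\<close>.\<close>
  have "U \<subseteq> D"
  proof
    fix z assume "z \<in> U"
    show "z \<in> D"
    proof (rule ccontr)
      assume "z \<notin> D"
      then have "(f ^^ n) z \<notin> D" for n
        by (induction n) (auto dest: f_out)
      moreover have "\<forall>\<^sub>F n in sequentially. (f ^^ n) z \<in> D"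
        using topological_tendstoD[OF U(3)[OF \<open>z \<in> U\<close>] \<open>open D\<close>] \<open>a \<in> V\<close> \<open>V \<subseteq> D\<close> by blast
      ultimately show False by simp
    qed
  qed
  moreover have "inner_parallel_set D \<delta> \<subseteq> U"
    using \<open>S \<subseteq> V\<close> U(2) by (force simp: inner_parallel_set_def S_def)
  ultimately show ?thesis using hol U(1) by blast
qed

end
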